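(* Let $k\ge1$, let $G$ be a signed complex representing an element of the strong ring, and let $V$ be the set of zero-dimensional cells of $G$. Then the curvature function $K_{G,k}$ on $V$ satisfies $\sum_{v\in V}K_{G,k}(v)=\omega_k(G)$. If $G=A\times B$ is the product of two signed complexes and $v=(a,b)$ is a zero-dimensional cell of $G$, then $K_{G,k}(v)=K_{A,k}(a)\,K_{B,k}(b)$.
   Context: A finite abstract simplicial complex is a finite set of finite non-empty sets which is closed under taking non-empty subsets; $\dim(x)=|x|-1$. A product complex is a finite Cartesian product $G_1\times\cdots\times G_n$ ($n\ge 1$) of finite abstract simplicial complexes; its cells are the sets $x=x_1\times\cdots\times x_n$ with $x_i\in G_i$, with $\dim(x)=\sum_i\dim(x_i)$ and $\omega(x)=(-1)^{\dim(x)}$. A signed complex is a finite formal disjoint union of product complexes, each summand carrying a sign in $\{1,-1\}$; cells in different summands are disjoint. Products of signed complexes are taken term by term, signs being multiplied (no cancellation is performed). Elements of the strong ring are represented by signed complexes. For a product complex $G$, the $k$-th Wu characteristic is $\omega_k(G)=\sum\omega(x_1)\cdots\omega(x_k)$, the sum being over all ordered $k$-tuples of cells with $x_1\cap\cdots\cap x_k\ne\emptyset$; for a signed complex with summands $G_i$ and signs $\varepsilon_i$, $\omega_k(G)=\sum_i\varepsilon_i\omega_k(G_i)$. For a cell $x$ in a summand of sign $\varepsilon(x)$, put $\omega_k(x)=\varepsilon(x)\sum_{(x_2,\dots,x_k)}\omega(x)\omega(x_2)\cdots\omega(x_k)$, the sum being over all $(k-1)$-tuples of cells with $x\cap x_2\cap\cdots\cap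 x_k\neq\emptyset$ (for $k=1$, $\omega_1(x)=\varepsilon(x)\omega(x)$). The curvature is obtained by distributing these values equally to the zero-dimensional cells contained in each cell: $$K_{G,k}(v)=\sum_{x\supseteq v}\frac{\omega_k(x)}{|x|},$$ where $|x|=\prod_i|x_i|$ is the number of zero-dimensional cells contained in $x=x_1\times\cdots\times x_n$. *)

theory Defs
  imports Complex_Main
begin

definition simplicial_complex :: "'a set set \<Rightarrow> bool" where
  "simplicial_complex C \<longleftrightarrow>
     finite C \<and> (\<forall>x\<in>C. finite x \<and> x \<noteq> {}) \<and> (\<forall>x\<in>C. \<forall>y. y \<subseteq> x \<and> y \<noteq> {} \<longrightarrow> y \<in> C)"

text \<open>
  A product complex is given by the list of its factors, and a cell of it by the list
  of the simplices whose Cartesian product it is; the cell as a set of tuples is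
  \<^const>\<open>listset\<close> of that list. As all simplices are nonempty, no information is lost
  (\<open>inj_on_listset\<close> below).
\<close>

definition product_complex :: "'a set set list \<Rightarrow> bool" where
  "product_complex Cs \<longleftrightarrow> Cs \<noteq> [] \<and> (\<forall>C\<in>set Cs. simplicial_complex C)"

definition product_cells :: "'a set set list \<Rightarrow> 'a set list set" where
  "product_cells Cs = listset Cs"

definition cell_dim :: "'a set list \<Rightarrow> nat" where
  "cell_dim x = (\<Sum>s\<leftarrow>x. card s - 1)"

definition cell_sign :: "'a set list \<Rightarrow> int" where
  "cell_sign x = (-1) ^ cell_dim x"

definition cell_size :: "'a set list \<Rightarrow> nat" where
  "cell_size x = (\<Prod>s\<leftarrow>x. card s)"

definition product_wu :: "nat \<Rightarrow> 'a set set list \<Rightarrow> int" where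
  "product_wu k Cs =
     (\<Sum>xs | length xs = k \<and> set xs \<subseteq> product_cells Cs \<and> (\<Inter>x\<in>set xs. listset x) \<noteq> {}.
        \<Prod>x\<leftarrow>xs. cell_sign x)"

text \<open>
  A formal disjoint union is a family of product complexes over an index set. A cell of it
  carries the index of its summand, which makes cells of different summands disjoint.
\<close>

record ('i, 'a) signed_complex =
  summands :: "'i set"
  summand_sign :: "'i \<Rightarrow> int"
  summand_complex :: "'i \<Rightarrow> 'a set set list"

definition is_signed_complex :: "('i, 'a) signed_complex \<Rightarrow> bool" where
  "is_signed_complex G \<longleftrightarrow> finite (summands G) \<and>
     (\<forall>i\<in>summands G. summand_sign G i \<in> {1, -1} \<and> product_complex (summand_complex G i))"

definition signed_cells :: "('i, 'a) signed_complex \<Rightarrow> ('i \<times> 'a set list) set" where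
  "signed_cells G = (SIGMA i:summands G. product_cells (summand_complex G i))"

definition cell_points :: "'i \<times> 'a set list \<Rightarrow> ('i \<times> 'a list) set" where
  "cell_points c = {fst c} \<times> listset (snd c)"

definition zero_cells :: "('i, 'a) signed_complex \<Rightarrow> ('i \<times> 'a set list) set" where
  "zero_cells G = {c \<in> signed_cells G. cell_dim (snd c) = 0}"

definition wu_characteristic :: "nat \<Rightarrow> ('i, 'a) signed_complex \<Rightarrow> int" where
  "wu_characteristic k G =
     (\<Sum>i\<in>summands G. summand_sign G i * product_wu k (summand_complex G i))"

definition wu_cell :: "nat \<Rightarrow> ('i, 'a) signed_complex \<Rightarrow> 'i \<times> 'a set list \<Rightarrow> int" where
  "wu_cell k G c = summand_sign G (fst c) *
     (\<Sum>ds | length ds = k - 1 \<and> set ds \<subseteq> signed_cells G \<and>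
             (\<Inter>d\<in>set (c # ds). cell_points d) \<noteq> {}.
        cell_sign (snd c) * (\<Prod>d\<leftarrow>ds. cell_sign (snd d)))"

definition curvature :: "nat \<Rightarrow> ('i, 'a) signed_complex \<Rightarrow> 'i \<times> 'a set list \<Rightarrow> real" where
  "curvature k G v =
     (\<Sum>c | c \<in> signed_cells G \<and> cell_points v \<subseteq> cell_points c.
        of_int (wu_cell k G c) / of_nat (cell_size (snd c)))"

definition signed_product ::
    "('i, 'a) signed_complex \<Rightarrow> ('j, 'a) signed_complex \<Rightarrow> ('i \<times> 'j, 'a) signed_complex" where
  "signed_product A B =
     \<lparr>summands = summands A \<times> summands B,
      summand_sign = (\<lambda>(i, j). summand_sign A i * summand_sign B j),
      summand_complex = (\<lambda>(i, j). summand_complex A i @ summand_complex B j)\<rparr>"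

definition cell_product ::
    "'i \<times> 'a set list \<Rightarrow> 'j \<times> 'a set list \<Rightarrow> ('i \<times> 'j) \<times> 'a set list" where
  "cell_product a b = ((fst a, fst b), snd a @ snd b)"


lemma in_listset_iff: "xs \<in> listset Cs \<longleftrightarrow> list_all2 (\<in>) xs Cs"
  by (induction Cs arbitrary: xs) (auto simp: set_Cons_def list_all2_Cons2)

lemma listset_eq_empty_iff: "listset x = {} \<longleftrightarrow> {} \<in> set x"
  by (induction x) (auto simp: set_Cons_def)

lemma product_cells_nonempty:
  assumes "product_complex Cs" "x \<in> product_cells Cs"
  shows "\<forall>s\<in>set x. finite s \<and> s \<noteq> {}"
proof
  fix s assume "s \<in> set x"
  then obtain C where "C \<in> set Cs" "s \<in> C"
    using assms(2) unfolding product_cells_def in_listset_iff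
    by (metis in_set_conv_nth list_all2_conv_all_nth)
  then show "finite s \<and> s \<noteq> {}"
    using assms(1) by (auto simp: product_complex_def simplicial_complex_def)
qed

lemma listset_inject:
  assumes "listset x = listset y" "{} \<notin> set x" "{} \<notin> set y"
  shows "x = y"
  using assms
proof (induction x arbitrary: y)
  case Nil
  then have "[] \<in> listset y" by (metis listset.simps(1) singletonI)
  then show ?case by (simp add: in_listset_iff)
next
  case (Cons s x)
  have ne: "listset x \<noteq> {}" "s \<noteq> {}"
    using Cons.prems listset_eq_empty_iff by auto
  show ?case
  proof (cases y)
    case Nil
    then have "[] \<in> listset (s # x)" using Cons.prems(1) by simp
    then show ?thesis by (simp add: set_Cons_def)
  next
    case (Cons t z)
    have ne': "listset z \<noteq> {}" "t \<noteq> {}"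
      using Cons.prems(3) Cons listset_eq_empty_iff by auto
    have eq: "p \<in> s \<and> q \<in> listset x \<longleftrightarrow> p \<in> t \<and> q \<in> listset z" for p q
    proof -
      have "p # q \<in> listset (s # x) \<longleftrightarrow> p # q \<in> listset (t # z)"
        using Cons.prems(1) Cons by simp
      then show ?thesis by (simp add: set_Cons_def)
    qed
    have "s = t" "listset x = listset z" using eq ne ne' by blast+
    then show ?thesis using Cons.IH[of z] Cons.prems(2,3) Cons by simp
  qed
qed

lemma inj_on_listset: "product_complex Cs \<Longrightarrow> inj_on listset (product_cells Cs)"
  by (meson inj_onI listset_inject product_cells_nonempty)

lemma card_listset: "card (listset x) = cell_size x"
proof (induction x)
  case (Cons s x)
  have "listset (s # x) = (\<lambda>(p, q). p # q) ` (s \<times> listset x)"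
    by (auto simp: set_Cons_def)
  then have "card (listset (s # x)) = card (s \<times> listset x)"
    by (simp add: card_image inj_on_def)
  then show ?case
    using Cons by (simp add: cell_size_def card_cartesian_product)
qed (simp add: cell_size_def)

lemma is_signed_complex_product:
  "is_signed_complex A \<Longrightarrow> is_signed_complex B \<Longrightarrow> is_signed_complex (signed_product A B)"
  by (fastforce simp: is_signed_complex_def signed_product_def product_complex_def)

lemma listset_append: "listset (Cs @ Ds) = (\<lambda>(y, z). y @ z) ` (listset Cs \<times> listset Ds)"
proof -
  have "x \<in> listset (Cs @ Ds) \<longleftrightarrow> (\<exists>y z. x = y @ z \<and> y \<in> listset Cs \<and> z \<in> listset Ds)" for x
    unfolding in_listset_iff list_all2_append2 using list_all2_lengthD by blast
  then show ?thesis by auto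
qed

lemma signed_cells_product:
  "signed_cells (signed_product A B) =
     (\<lambda>(a, b). cell_product a b) ` (signed_cells A \<times> signed_cells B)"
proof (intro equalityI subsetI)
  fix c assume "c \<in> signed_cells (signed_product A B)"
  then obtain i j y z where "c = ((i, j), y @ z)" "(i, y) \<in> signed_cells A" "(j, z) \<in> signed_cells B"
    by (auto simp: signed_cells_def signed_product_def product_cells_def listset_append)
  then show "c \<in> (\<lambda>(a, b). cell_product a b) ` (signed_cells A \<times> signed_cells B)"
    by (intro image_eqI[of _ _ "((i, y), (j, z))"]) (auto simp: cell_product_def)
next
  fix c assume "c \<in> (\<lambda>(a, b). cell_product a b) ` (signed_cells A \<times> signed_cells B)"
  then show "c \<in> signed_cells (signed_product A B)"
    by (auto simp: signed_cells_def signed_product_def product_cells_def listset_append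
        cell_product_def)
qed

lemma cell_dim_product_eq_0_iff:
  "cell_dim (snd (cell_product a b)) = 0 \<longleftrightarrow> cell_dim (snd a) = 0 \<and> cell_dim (snd b) = 0"
  unfolding cell_product_def cell_dim_def snd_conv map_append sum_list_append add_is_0 ..

lemma zero_cells_product:
  "zero_cells (signed_product A B) =
     (\<lambda>(a, b). cell_product a b) ` (zero_cells A \<times> zero_cells B)"
  unfolding zero_cells_def signed_cells_product
  using cell_dim_product_eq_0_iff by fastforce

end

theory Submission
  imports Defs
begin

text \<open>
  Gauss--Bonnet is double counting. A cell \<open>c\<close> contains exactly \<^term>\<open>cell_size (snd c)\<close>
  zero-dimensional cells, one for each tuple in the Cartesian product, so distributing
  \<^term>\<open>wu_cell k G c\<close> equally among them and summing over all vertices gives back the sum of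
  \<^term>\<open>wu_cell k G c\<close> over all cells (\<open>sum_curvature_eq_sum_wu_cell\<close>). Splitting a \<open>k\<close>-tuple of
  cells with a common point into its head and its tail identifies that sum with the Wu
  characteristic (\<open>sum_wu_cell\<close>); cells with a common point lie in the same summand, so nothing
  mixes different summands.

  Multiplicativity holds term by term. Every cell of a product is \<^term>\<open>cell_product x y\<close> for
  unique cells \<open>x\<close>, \<open>y\<close>: the summand index tells how many factors belong to \<open>x\<close>. The sign and the
  number of points of a cell are multiplicative. A family of product cells has a common point iff
  both families of components have one, and one product cell contains another iff this holds for
  both components. So the tuples that define \<open>wu_cell\<close> of a product cell are the pairs of
  tuples for its components, which makes \<open>wu_cell\<close> multiplicative
  (\<open>wu_cell_product\<close>); and the cells around a product vertex are the products of the cells around its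
  components, so the curvature sum factors as well.
\<close>

section \<open>Finiteness\<close>

lemma finite_listset:
  assumes "\<forall>C\<in>set Cs. finite C"
  shows "finite (listset Cs)"
  using assms
proof (induction Cs)
  case (Cons C Cs)
  have "listset (C # Cs) = (\<lambda>(x, xs). x # xs) ` (C \<times> listset Cs)"
    by (auto simp: set_Cons_def)
  then show ?case using Cons by simp
qed simp

lemma finite_product_cells: "product_complex Cs \<Longrightarrow> finite (product_cells Cs)"
  by (simp add: product_cells_def product_complex_def simplicial_complex_def finite_listset)

lemma finite_signed_cells: "is_signed_complex G \<Longrightarrow> finite (signed_cells G)"
  by (simp add: signed_cells_def is_signed_complex_def finite_product_cells)

lemma signed_cells_nonempty:
  assumes "is_signed_complex G" "c \<in> signed_cells G" "s \<in> set (snd c)"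
  shows "finite s" "s \<noteq> {}"
  using assms product_cells_nonempty
  by (fastforce simp: signed_cells_def is_signed_complex_def)+

section \<open>Double counting\<close>

lemma mem_listset_iff_singletons_subset:
  "p \<in> listset x \<longleftrightarrow> listset (map (\<lambda>a. {a}) p) \<subseteq> listset x"
proof -
  have "listset (map (\<lambda>a. {a}) p) = {p}"
    by (induction p) (auto simp: set_Cons_def)
  then show ?thesis by simp
qed

text \<open>
  This is where closure under nonempty subsets enters: the points of a cell are themselves
  cells of the complex.
\<close>

lemma singletons_in_product_cells:
  assumes "product_complex Cs" "x \<in> product_cells Cs" "p \<in> listset x"
  shows "map (\<lambda>a. {a}) p \<in> product_cells Cs"
proof -
  have x: "list_all2 (\<in>) x Cs" and p: "list_all2 (\<in>) p x"
    using assms(2,3) by (auto simp: product_cells_def in_listset_iff)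
  have len: "length p = length x" "length x = length Cs"
    using x p by (auto dest: list_all2_lengthD)
  have "{p ! n} \<in> Cs ! n" if "n < length Cs" for n
  proof -
    have "x ! n \<in> Cs ! n" "p ! n \<in> x ! n"
      using that len x p by (auto simp: list_all2_conv_all_nth)
    moreover have "\<forall>y. y \<subseteq> x ! n \<and> y \<noteq> {} \<longrightarrow> y \<in> Cs ! n" if "x ! n \<in> Cs ! n"
      using assms(1) that \<open>n < length Cs\<close>
      by (simp add: product_complex_def simplicial_complex_def)
    ultimately show ?thesis by simp
  qed
  then show ?thesis
    using len by (simp add: product_cells_def in_listset_iff list_all2_conv_all_nth)
qed

lemma cell_dim_eq_0_imp_singletons:
  assumes "cell_dim x = 0" "\<forall>s\<in>set x. finite s \<and> s \<noteq> {}"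
  shows "\<exists>p. x = map (\<lambda>a. {a}) p"
  using assms
proof (induction x)
  case (Cons s x)
  have "card s = 1"
    using Cons.prems card_gt_0_iff[of s] by (simp add: cell_dim_def)
  then obtain a where "s = {a}" by (auto simp: card_1_singleton_iff)
  moreover obtain p where "x = map (\<lambda>a. {a}) p"
    using Cons by (auto simp: cell_dim_def)
  ultimately have "s # x = map (\<lambda>a. {a}) (a # p)" by simp
  then show ?case by (rule exI)
qed simp

text \<open>
  Two cells are comparable by \<^const>\<open>cell_points\<close> only inside one summand, so the vertices below
  \<open>(i, x)\<close> correspond to the points of the Cartesian product of \<open>x\<close>.
\<close>

lemma card_zero_cells_below:
  assumes G: "is_signed_complex G" and c: "c \<in> signed_cells G"
  shows "card {v \<in> zero_cells G. cell_points v \<subseteq> cell_points c} = cell_size (snd c)"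
proof -
  obtain i x where ix: "c = (i, x)" by (cases c)
  have i: "i \<in> summands G" and x: "x \<in> product_cells (summand_complex G i)"
    using c ix by (auto simp: signed_cells_def)
  have pc: "product_complex (summand_complex G i)"
    using G i by (simp add: is_signed_complex_def)
  define vertex where "vertex p = (i, map (\<lambda>a. {a}) p)" for p :: "'b list"
  have dim0: "cell_dim (map (\<lambda>a. {a}) p) = 0" for p :: "'b list"
    by (simp add: cell_dim_def)
  have points: "cell_points (vertex p) \<subseteq> cell_points c \<longleftrightarrow> p \<in> listset x" for p
    by (auto simp: vertex_def cell_points_def ix mem_listset_iff_singletons_subset[of p x])
  have "{v \<in> zero_cells G. cell_points v \<subseteq> cell_points c} = vertex ` listset x"
  proof (intro equalityI subsetI)
    fix v assume v: "v \<in> {v \<in> zero_cells G. cell_points v \<subseteq> cell_points c}"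
    then have vG: "v \<in> signed_cells G" and "cell_dim (snd v) = 0"
      by (auto simp: zero_cells_def)
    then obtain p where p: "snd v = map (\<lambda>a. {a}) p"
      using cell_dim_eq_0_imp_singletons signed_cells_nonempty[OF G vG] by blast
    have "p \<in> listset (snd v)"
      by (simp add: p mem_listset_iff_singletons_subset)
    then have "(fst v, p) \<in> cell_points c"
      using v by (auto simp: cell_points_def)
    then have "v = vertex p" "p \<in> listset x"
      using p by (auto simp: vertex_def cell_points_def ix prod_eq_iff)
    then show "v \<in> vertex ` listset x" by blast
  next
    fix v assume "v \<in> vertex ` listset x"
    then obtain p where p: "v = vertex p" "p \<in> listset x" by blast
    then have "v \<in> signed_cells G"
      using singletons_in_product_cells[OF pc x] i by (simp add: vertex_def signed_cells_def)
    then show "v \<in> {v \<in> zero_cells G. cell_points v \<subseteq> cell_points c}"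
      using p points dim0 by (auto simp: zero_cells_def vertex_def)
  qed
  moreover have "inj vertex"
    by (auto simp: vertex_def inj_def dest: map_injective)
  ultimately show ?thesis
    by (simp add: card_image inj_on_subset card_listset ix)
qed

lemma sum_curvature_eq_sum_wu_cell:
  assumes G: "is_signed_complex G"
  shows "(\<Sum>v\<in>zero_cells G. curvature k G v) = of_int (\<Sum>c\<in>signed_cells G. wu_cell k G c)"
proof -
  let ?w = "\<lambda>c. of_int (wu_cell k G c) / of_nat (cell_size (snd c)) :: real"
  have fin: "finite (signed_cells G)" "finite (zero_cells G)"
    using finite_signed_cells[OF G] rev_finite_subset[of "signed_cells G" "zero_cells G"]
    unfolding zero_cells_def by blast+
  have "(\<Sum>v\<in>zero_cells G. curvature k G v) =
      (\<Sum>v\<in>zero_cells G. \<Sum>c | c \<in> signed_cells G \<and> cell_points v \<subseteq> cell_points c. ?w c)"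
    unfolding curvature_def ..
  also have "\<dots> = (\<Sum>c\<in>signed_cells G.
      \<Sum>v | v \<in> zero_cells G \<and> cell_points v \<subseteq> cell_points c. ?w c)"
    by (rule sum.swap_restrict[OF fin(2,1)])
  also have "\<dots> = (\<Sum>c\<in>signed_cells G. of_int (wu_cell k G c))"
  proof (rule sum.cong[OF refl])
    fix c assume c: "c \<in> signed_cells G"
    have "card s \<noteq> 0" if "s \<in> set (snd c)" for s
      using signed_cells_nonempty[OF G c that] by simp
    then have "0 \<notin> card ` set (snd c)"
      by (metis imageE)
    then have "cell_size (snd c) \<noteq> 0"
      unfolding cell_size_def prod_list_zero_iff set_map .
    then show "(\<Sum>v | v \<in> zero_cells G \<and> cell_points v \<subseteq> cell_points c. ?w c) =
        of_int (wu_cell k G c)"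
      by (simp only: sum_constant card_zero_cells_below[OF G c]) simp
  qed
  also have "\<dots> = of_int (\<Sum>c\<in>signed_cells G. wu_cell k G c)"
    by (rule of_int_sum[symmetric])
  finally show ?thesis .
qed

section \<open>The Wu characteristic as a sum over cells\<close>

text \<open>
  Only tuples inside the summand of the cell contribute, since points of different summands
  are distinct.
\<close>

lemma wu_cell_in_summand:
  assumes "i \<in> summands G"
  shows "wu_cell k G (i, x) = summand_sign G i *
    (\<Sum>xs | length xs = k - 1 \<and> set xs \<subseteq> product_cells (summand_complex G i) \<and>
            (\<Inter>y\<in>set (x # xs). listset y) \<noteq> {}.
       \<Prod>y\<leftarrow>x # xs. cell_sign y)"
proof -
  let ?S = "{xs. length xs = k - 1 \<and> set xs \<subseteq> product_cells (summand_complex G i) \<and>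
            (\<Inter>y\<in>set (x # xs). listset y) \<noteq> {}}"
  let ?T = "{ds. length ds = k - 1 \<and> set ds \<subseteq> signed_cells G \<and>
            (\<Inter>d\<in>set ((i, x) # ds). cell_points d) \<noteq> {}}"
  have "?T = map (Pair i) ` ?S"
  proof (intro equalityI subsetI)
    fix ds assume ds: "ds \<in> ?T"
    then have "(\<Inter>d\<in>set ((i, x) # ds). cell_points d) \<noteq> {}" by blast
    then obtain z where z: "z \<in> (\<Inter>d\<in>set ((i, x) # ds). cell_points d)" by blast
    define p where "p = snd z"
    have "fst z = i" using z by (simp add: cell_points_def mem_Times_iff)
    then have p: "\<forall>d\<in>set ((i, x) # ds). fst d = i \<and> p \<in> listset (snd d)"
      using z by (auto simp: p_def cell_points_def mem_Times_iff)
    then have eq: "ds = map (Pair i) (map snd ds)"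
      unfolding map_map by (intro map_idI[symmetric]) (auto simp: prod_eq_iff)
    have "p \<in> (\<Inter>y\<in>set (x # map snd ds). listset y)"
      using p by simp
    then have "(\<Inter>y\<in>set (x # map snd ds). listset y) \<noteq> {}" by blast
    moreover have "set (map snd ds) \<subseteq> product_cells (summand_complex G i)"
      using ds p by (fastforce simp: signed_cells_def)
    ultimately have "map snd ds \<in> ?S" using ds by simp
    then show "ds \<in> map (Pair i) ` ?S" using eq by blast
  next
    fix ds assume "ds \<in> map (Pair i) ` ?S"
    then obtain xs where xs: "ds = map (Pair i) xs" "xs \<in> ?S" by blast
    then have "(\<Inter>y\<in>set (x # xs). listset y) \<noteq> {}" by blast
    then obtain p where "p \<in> (\<Inter>y\<in>set (x # xs). listset y)" by blast
    then have "(i, p) \<in> (\<Inter>d\<in>set ((i, x) # ds). cell_points d)"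
      using xs(1) by (simp add: cell_points_def)
    then have "(\<Inter>d\<in>set ((i, x) # ds). cell_points d) \<noteq> {}" by blast
    moreover have "length ds = k - 1" "set ds \<subseteq> signed_cells G"
      using xs assms by (auto simp: signed_cells_def)
    ultimately show "ds \<in> ?T" by blast
  qed
  moreover have "inj_on (map (Pair i)) ?S"
    by (rule inj_on_subset[OF inj_mapI]) (auto simp: inj_def)
  ultimately show ?thesis
    by (simp add: wu_cell_def sum.reindex comp_def)
qed

lemma product_wu_eq_sum_heads:
  assumes "k \<ge> 1" "product_complex Cs"
  shows "product_wu k Cs = (\<Sum>x\<in>product_cells Cs.
    \<Sum>xs | length xs = k - 1 \<and> set xs \<subseteq> product_cells Cs \<and>
           (\<Inter>y\<in>set (x # xs). listset y) \<noteq> {}.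
      \<Prod>y\<leftarrow>x # xs. cell_sign y)"
proof -
  let ?S = "\<lambda>x. {xs. length xs = k - 1 \<and> set xs \<subseteq> product_cells Cs \<and>
            (\<Inter>y\<in>set (x # xs). listset y) \<noteq> {}}"
  have fin: "finite (product_cells Cs)" by (rule finite_product_cells[OF assms(2)])
  have "finite (?S x)" for x
    by (rule finite_subset[OF _ finite_lists_length_eq[OF fin, of "k - 1"]]) auto
  then have "(\<Sum>x\<in>product_cells Cs. \<Sum>xs\<in>?S x. \<Prod>y\<leftarrow>x # xs. cell_sign y) =
      (\<Sum>(x, xs)\<in>(SIGMA x:product_cells Cs. ?S x). \<Prod>y\<leftarrow>x # xs. cell_sign y)"
    using fin by (intro sum.Sigma) auto
  also have "\<dots> = product_wu k Cs"
    unfolding product_wu_def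
  proof (rule sum.reindex_bij_witness[where i = "\<lambda>zs. (hd zs, tl zs)"
        and j = "\<lambda>(x, xs). x # xs"], goal_cases)
    case (4 zs)
    then have "zs \<noteq> []" using assms(1) by auto
    then obtain x xs where "zs = x # xs" by (meson neq_Nil_conv)
    then show ?case using 4 by auto
  next
    case (3 zs)
    then have "zs \<noteq> []" using assms(1) by auto
    then show ?case by simp
  qed (use assms(1) in auto)
  finally show ?thesis by simp
qed

lemma sum_wu_cell:
  assumes "k \<ge> 1" and G: "is_signed_complex G"
  shows "(\<Sum>c\<in>signed_cells G. wu_cell k G c) = wu_characteristic k G"
proof -
  have "(\<Sum>c\<in>signed_cells G. wu_cell k G c) =
      (\<Sum>i\<in>summands G. \<Sum>x\<in>product_cells (summand_complex G i). wu_cell k G (i, x))"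
    unfolding signed_cells_def using G
    by (subst sum.Sigma) (auto simp: is_signed_complex_def finite_product_cells)
  also have "\<dots> = wu_characteristic k G"
    unfolding wu_characteristic_def
    using G by (intro sum.cong refl)
      (simp add: wu_cell_in_summand product_wu_eq_sum_heads[OF assms(1)] sum_distrib_left
        is_signed_complex_def)
  finally show ?thesis .
qed

section \<open>Products\<close>

lemma length_signed_cell:
  "c \<in> signed_cells G \<Longrightarrow> length (snd c) = length (summand_complex G (fst c))"
  by (auto simp: signed_cells_def product_cells_def in_listset_iff dest: list_all2_lengthD)

text \<open>
  The concatenated list alone does not determine where to cut, because summands may have
  different numbers of factors; the summand index does.
\<close>

lemma inj_on_cell_product:
  "inj_on (\<lambda>(x, y). cell_product x y) (signed_cells A \<times> signed_cells B)"
proof (rule inj_onI)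
  fix p q
  assume p: "p \<in> signed_cells A \<times> signed_cells B" and q: "q \<in> signed_cells A \<times> signed_cells B"
    and eq: "(\<lambda>(x, y). cell_product x y) p = (\<lambda>(x, y). cell_product x y) q"
  then have "length (snd (fst p)) = length (snd (fst q))"
    using length_signed_cell[of "fst p" A] length_signed_cell[of "fst q" A]
    by (auto simp: cell_product_def case_prod_unfold)
  then show "p = q"
    using eq by (auto simp: cell_product_def case_prod_unfold prod_eq_iff)
qed

lemma mem_listset_append_iff:
  "r \<in> listset (x @ y) \<longleftrightarrow>
     take (length x) r \<in> listset x \<and> drop (length x) r \<in> listset y"
proof
  assume "r \<in> listset (x @ y)"
  then obtain p q where "r = p @ q" "p \<in> listset x" "q \<in> listset y"
    by (auto simp: listset_append)
  moreover from this have "length p = length x"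
    by (auto simp: in_listset_iff dest: list_all2_lengthD)
  ultimately show "take (length x) r \<in> listset x \<and> drop (length x) r \<in> listset y" by simp
next
  assume "take (length x) r \<in> listset x \<and> drop (length x) r \<in> listset y"
  then show "r \<in> listset (x @ y)"
    unfolding listset_append
    by (intro image_eqI[of _ _ "(take (length x) r, drop (length x) r)"]) auto
qed

lemma cell_points_product_iff:
  assumes "x \<in> signed_cells A"
  shows "((i, j), r) \<in> cell_points (cell_product x y) \<longleftrightarrow>
    (i, take (length (summand_complex A i)) r) \<in> cell_points x \<and>
    (j, drop (length (summand_complex A i)) r) \<in> cell_points y"
  using length_signed_cell[OF assms]
  by (auto simp: cell_points_def cell_product_def mem_listset_append_iff)

lemma cell_points_productI:
  "(i, p) \<in> cell_points x \<Longrightarrow> (j, q) \<in> cell_points y \<Longrightarrow>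
    ((i, j), p @ q) \<in> cell_points (cell_product x y)"
  by (auto simp: cell_points_def cell_product_def listset_append)

text \<open>
  All the cells \<open>x\<close> through a common point lie in one summand of \<open>A\<close>, so the coordinate tuple of
  that point can be cut at the same position for every pair of the family.
\<close>

lemma common_point_product_iff:
  assumes "set ps \<subseteq> signed_cells A \<times> signed_cells B"
  shows "(\<Inter>(x, y)\<in>set ps. cell_points (cell_product x y)) \<noteq> {} \<longleftrightarrow>
    (\<Inter>(x, y)\<in>set ps. cell_points x) \<noteq> {} \<and> (\<Inter>(x, y)\<in>set ps. cell_points y) \<noteq> {}"
    (is "?L \<longleftrightarrow> ?R")
proof
  assume ?L
  then obtain i j r where r: "\<forall>(x, y)\<in>set ps. ((i, j), r) \<in> cell_points (cell_product x y)"
    by fastforce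
  let ?n = "length (summand_complex A i)"
  have "\<forall>(x, y)\<in>set ps. (i, take ?n r) \<in> cell_points x \<and> (j, drop ?n r) \<in> cell_points y"
    using r assms cell_points_product_iff by fastforce
  then have "(i, take ?n r) \<in> (\<Inter>(x, y)\<in>set ps. cell_points x)"
    "(j, drop ?n r) \<in> (\<Inter>(x, y)\<in>set ps. cell_points y)"
    by auto
  then show ?R by blast
next
  assume ?R
  then obtain i p j q where "\<forall>(x, y)\<in>set ps. (i, p) \<in> cell_points x"
    "\<forall>(x, y)\<in>set ps. (j, q) \<in> cell_points y"
    by fastforce
  then have "((i, j), p @ q) \<in> (\<Inter>(x, y)\<in>set ps. cell_points (cell_product x y))"
    using cell_points_productI by fastforce
  then show ?L by blast
qed

text \<open>
  Inclusion of products passes to the factors only because no factor is empty: a point of \<open>a\<close>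
  is tested by pairing it with an arbitrary point of \<open>b\<close>, and vice versa.
\<close>

lemma cell_points_product_subset_iff:
  assumes "is_signed_complex A" "is_signed_complex B"
    and a: "a \<in> signed_cells A" and b: "b \<in> signed_cells B" and x: "x \<in> signed_cells A"
  shows "cell_points (cell_product a b) \<subseteq> cell_points (cell_product x y) \<longleftrightarrow>
    cell_points a \<subseteq> cell_points x \<and> cell_points b \<subseteq> cell_points y" (is "?L \<longleftrightarrow> ?R")
proof
  have "listset (snd a) \<noteq> {}" "listset (snd b) \<noteq> {}"
    using signed_cells_nonempty(2)[OF assms(1) a] signed_cells_nonempty(2)[OF assms(2) b]
    by (auto simp: listset_eq_empty_iff)
  then obtain p\<^sub>0 q\<^sub>0 where ne: "(fst a, p\<^sub>0) \<in> cell_points a" "(fst b, q\<^sub>0) \<in> cell_points b"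
    by (auto simp: cell_points_def)
  assume L: ?L
  have *: "(fst a, p) \<in> cell_points x \<and> (fst b, q) \<in> cell_points y"
    if "(fst a, p) \<in> cell_points a" "(fst b, q) \<in> cell_points b" for p q
  proof -
    have "length p = length (summand_complex A (fst a))"
      using that(1) length_signed_cell[OF a]
      by (auto simp: cell_points_def in_listset_iff dest: list_all2_lengthD)
    moreover have "((fst a, fst b), p @ q) \<in> cell_points (cell_product x y)"
      using L cell_points_productI[OF that] by blast
    ultimately show ?thesis
      by (simp add: cell_points_product_iff[OF x])
  qed
  show ?R
    using *[OF _ ne(2)] *[OF ne(1)] by (auto simp: cell_points_def)
next
  assume R: ?R
  show ?L
  proof
    fix z assume z: "z \<in> cell_points (cell_product a b)"
    obtain i j r where ijr: "z = ((i, j), r)" by (metis prod.collapse)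
    show "z \<in> cell_points (cell_product x y)"
      using z R unfolding ijr cell_points_product_iff[OF a] cell_points_product_iff[OF x]
      by blast
  qed
qed

lemma cell_sign_product:
  "cell_sign (snd (cell_product x y)) = cell_sign (snd x) * cell_sign (snd y)"
  by (simp add: cell_sign_def cell_dim_def cell_product_def power_add)

lemma cell_size_product:
  "cell_size (snd (cell_product x y)) = cell_size (snd x) * cell_size (snd y)"
  by (simp add: cell_size_def cell_product_def)

lemma prod_list_map_mult:
  "(\<Prod>p\<leftarrow>ps. f p * g p) = (\<Prod>p\<leftarrow>ps. f p) * (\<Prod>p\<leftarrow>ps. g p :: 'a :: comm_monoid_mult)"
  by (induction ps) (simp_all add: mult_ac)

text \<open>
  A tuple of product cells and a pair of tuples of cells are both encoded by a list of pairs
  of cells, so each of the two sums is reindexed to one over such lists.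
\<close>

lemma wu_cell_product:
  assumes x: "x \<in> signed_cells A" and y: "y \<in> signed_cells B"
  shows "wu_cell k (signed_product A B) (cell_product x y) = wu_cell k A x * wu_cell k B y"
proof -
  let ?P = "signed_product A B"
  let ?cp = "\<lambda>(x, y). cell_product x y"
  let ?common = "\<lambda>cs. (\<Inter>d\<in>set cs. cell_points d) \<noteq> {}"
  define TA where "TA = {xs. length xs = k - 1 \<and> set xs \<subseteq> signed_cells A \<and> ?common (x # xs)}"
  define TB where "TB = {ys. length ys = k - 1 \<and> set ys \<subseteq> signed_cells B \<and> ?common (y # ys)}"
  define TP where "TP = {zs. length zs = k - 1 \<and> set zs \<subseteq> signed_cells ?P \<and>
     (\<Inter>d\<in>set (cell_product x y # zs). cell_points d) \<noteq> {}}"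
  define S where "S = {ps. map fst ps \<in> TA \<and> map snd ps \<in> TB}"
  have set_S: "set ps \<subseteq> signed_cells A \<times> signed_cells B" if "ps \<in> S" for ps
    using that by (fastforce simp: S_def TA_def TB_def)
  have common: "(\<Inter>d\<in>set (cell_product x y # map ?cp ps). cell_points d) \<noteq> {} \<longleftrightarrow>
      ?common (x # map fst ps) \<and> ?common (y # map snd ps)"
    if "set ps \<subseteq> signed_cells A \<times> signed_cells B" for ps
    using common_point_product_iff[of "(x, y) # ps" A B] that x y
    by (simp add: case_prod_unfold image_image)
  have TP: "TP = map ?cp ` S"
  proof (intro equalityI subsetI)
    fix zs assume zs: "zs \<in> TP"
    then have "zs \<in> lists (?cp ` (signed_cells A \<times> signed_cells B))"
      by (auto simp: TP_def signed_cells_product)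
    then obtain ps where ps: "zs = map ?cp ps" "set ps \<subseteq> signed_cells A \<times> signed_cells B"
      by (auto simp: lists_image)
    then have "ps \<in> S"
      using zs common[OF ps(2)] by (fastforce simp: S_def TA_def TB_def TP_def)
    then show "zs \<in> map ?cp ` S" using ps(1) by blast
  next
    fix zs assume "zs \<in> map ?cp ` S"
    then obtain ps where ps: "zs = map ?cp ps" "ps \<in> S" by blast
    have "?common (x # map fst ps) \<and> ?common (y # map snd ps)" and len: "length ps = k - 1"
      using ps(2) unfolding S_def TA_def TB_def by simp_all
    then have "(\<Inter>d\<in>set (cell_product x y # zs). cell_points d) \<noteq> {}"
      unfolding ps(1) common[OF set_S[OF ps(2)]] by blast
    moreover have "set zs \<subseteq> signed_cells ?P"
      unfolding ps(1) signed_cells_product set_map by (intro image_mono set_S ps(2))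
    ultimately show "zs \<in> TP"
      using ps(1) len unfolding TP_def by simp
  qed
  have inj: "inj_on (map ?cp) S"
  proof (rule inj_onI)
    fix ps qs assume "ps \<in> S" "qs \<in> S" "map ?cp ps = map ?cp qs"
    moreover from this have "inj_on ?cp (set ps \<union> set qs)"
      using set_S by (intro inj_on_subset[OF inj_on_cell_product[of A B]]) blast
    ultimately show "ps = qs" by (simp add: inj_on_map_eq_map)
  qed
  have len: "length xs = length ys" if "xs \<in> TA" "ys \<in> TB" for xs ys
    using that by (simp add: TA_def TB_def)
  have split: "(\<Sum>ps\<in>S. f (map fst ps) * g (map snd ps)) = (\<Sum>xs\<in>TA. f xs) * (\<Sum>ys\<in>TB. g ys)"
    for f g :: "_ \<Rightarrow> int"
    unfolding sum_product sum.cartesian_product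
    by (rule sum.reindex_bij_witness[where j = "\<lambda>ps. (map fst ps, map snd ps)"
          and i = "\<lambda>(xs, ys). zip xs ys"])
      (auto simp: S_def len zip_map_fst_snd)
  let ?s = "\<lambda>cs. \<Prod>c\<leftarrow>cs. cell_sign (snd c)"
  have "wu_cell k ?P (cell_product x y) = summand_sign ?P (fst (cell_product x y)) *
      (\<Sum>zs\<in>TP. cell_sign (snd (cell_product x y)) * (\<Prod>z\<leftarrow>zs. cell_sign (snd z)))"
    by (simp add: wu_cell_def TP_def)
  also have "(\<Sum>zs\<in>TP. cell_sign (snd (cell_product x y)) * (\<Prod>z\<leftarrow>zs. cell_sign (snd z))) =
      (\<Sum>ps\<in>S. (cell_sign (snd x) * ?s (map fst ps)) * (cell_sign (snd y) * ?s (map snd ps)))"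
    unfolding TP sum.reindex[OF inj] comp_def
    by (intro sum.cong refl)
      (simp add: cell_sign_product comp_def case_prod_unfold prod_list_map_mult)
  also have "\<dots> = (\<Sum>xs\<in>TA. cell_sign (snd x) * ?s xs) * (\<Sum>ys\<in>TB. cell_sign (snd y) * ?s ys)"
    by (rule split)
  also have "summand_sign ?P (fst (cell_product x y)) =
      summand_sign A (fst x) * summand_sign B (fst y)"
    by (simp add: signed_product_def cell_product_def)
  finally show ?thesis
    by (simp add: wu_cell_def TA_def TB_def)
qed

lemma curvature_product:
  assumes "is_signed_complex A" "is_signed_complex B"
    and a: "a \<in> signed_cells A" and b: "b \<in> signed_cells B"
  shows "curvature k (signed_product A B) (cell_product a b) = curvature k A a * curvature k B b"
proof -
  let ?P = "signed_product A B"
  let ?cp = "\<lambda>(x, y). cell_product x y"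
  have star: "{c. c \<in> signed_cells ?P \<and> cell_points (cell_product a b) \<subseteq> cell_points c} =
      ?cp ` ({x \<in> signed_cells A. cell_points a \<subseteq> cell_points x} \<times>
             {y \<in> signed_cells B. cell_points b \<subseteq> cell_points y})"
    using cell_points_product_subset_iff[OF assms]
    by (fastforce simp: signed_cells_product)
  have inj: "inj_on ?cp ({x \<in> signed_cells A. cell_points a \<subseteq> cell_points x} \<times>
             {y \<in> signed_cells B. cell_points b \<subseteq> cell_points y})"
    by (rule inj_on_subset[OF inj_on_cell_product[of A B]]) auto
  show ?thesis
    unfolding curvature_def star sum.reindex[OF inj] sum_product sum.cartesian_product
    by (intro sum.cong refl) (auto simp: wu_cell_product cell_size_product)
qed

theorem theorem9:
  fixes k :: nat
    and G :: "('i, 'a) signed_complex"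
    and A :: "('j, 'b) signed_complex"
    and B :: "('l, 'b) signed_complex"
  assumes "k \<ge> 1"
  shows "(is_signed_complex G \<longrightarrow>
            (\<Sum>v\<in>zero_cells G. curvature k G v) = of_int (wu_characteristic k G)) \<and>
         (is_signed_complex A \<and> is_signed_complex B \<longrightarrow>
            (\<forall>a\<in>signed_cells A. \<forall>b\<in>signed_cells B.
               cell_product a b \<in> zero_cells (signed_product A B) \<longrightarrow>
               curvature k (signed_product A B) (cell_product a b) =
                 curvature k A a * curvature k B b))"
  using sum_curvature_eq_sum_wu_cell[of G k] sum_wu_cell[OF assms, of G] curvature_product
  by auto

end
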